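(* Let $n,k,\gamma$ be positive integers with $k\ge3\lceil\gamma/2\rceil$ and $n\ge2k+\gamma$. Then $$B_2(n,k,k+\gamma;3)\ge 2^{\left\lfloor\frac{n-2k+1}{k+1}\right\rfloor\left\lfloor\frac{k}{\lceil\gamma/2\rceil}\right\rfloor}.$$
   Context: For a prime power $q$, $\mathcal{G}_q(n,k)$ denotes the set of all $k$-dimensional subspaces of $\mathbb{F}_q^n$. An $\alpha$-$(n,k,\delta)_q^c$ covering Grassmannian code is a subset $\mathcal{C}\subseteq\mathcal{G}_q(n,k)$ (no repeated codewords) such that every set of $\alpha$ distinct codewords of $\mathcal{C}$ spans a subspace of $\mathbb{F}_q^n$ of dimension at least $k+\delta$. $B_q(n,k,\delta;\alpha)$ denotes the maximum size of an $\alpha$-$(n,k,\delta)_q^c$ code. *)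

theory Defs
  imports "HOL-Analysis.Analysis" "HOL-Library.Z2"
begin

text \<open>The ambient space F_2^n is modelled as bit ^ 'n with CARD('n) = n;
  subspaces, spans and dimensions are those of the library vector space
  interpretation vec (scalar multiplication (*s)).\<close>

definition grassmannian :: "nat \<Rightarrow> ((bit ^ 'n::finite) set) set" where
  "grassmannian k = {U. vec.subspace U \<and> vec.dim U = k}"

definition covering_code :: "nat \<Rightarrow> nat \<Rightarrow> nat \<Rightarrow> ((bit ^ 'n::finite) set) set \<Rightarrow> bool" where
  "covering_code \<alpha> k \<delta> C \<longleftrightarrow> C \<subseteq> grassmannian k \<and>
     (\<forall>S \<subseteq> C. card S = \<alpha> \<longrightarrow> k + \<delta> \<le> vec.dim (vec.span (\<Union>S)))"

definition B2 :: "'n::finite itself \<Rightarrow> nat \<Rightarrow> nat \<Rightarrow> nat \<Rightarrow> nat" where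
  "B2 _ k \<delta> \<alpha> = Max {card C | C :: ((bit ^ 'n) set) set. covering_code \<alpha> k \<delta> C}"

end

theory Submission
  imports Defs "HOL-Computational_Algebra.Polynomial"
begin

text \<open>
  For polynomials \<open>f\<close> over \<open>F\<^sub>2\<close> and a \<open>\<kappa>\<close>-dimensional space \<open>W\<close> of polynomials, put
  \<open>U f = {(v, f v) | v \<in> W}\<close>. The sum of three such spaces for distinct \<open>f\<^sub>1, f\<^sub>2, f\<^sub>3\<close> has
  dimension \<open>3\<kappa> - dim (W \<inter> \<rho>W)\<close> with \<open>\<rho> = (f\<^sub>1 - f\<^sub>3) / (f\<^sub>2 - f\<^sub>3)\<close>, a rational function
  other than \<open>0\<close> and \<open>1\<close>. For \<open>W\<close> spanned by \<open>1, x, \<dots>, x\<^bsup>\<kappa>-2\<^esup>, x\<^bsup>\<kappa>\<^esup>\<close> and \<open>\<kappa> \<ge> 3\<close>, unique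
  factorisation shows that this intersection has dimension at most \<open>\<kappa> - 2\<close>, so the sum has
  dimension at least \<open>2\<kappa> + 2\<close>. Taking the direct sum of \<open>g = \<lceil>\<gamma>/2\<rceil>\<close> such blocks, with the same
  \<open>f\<close> of degree below \<open>s\<close> in every block and block sizes \<open>\<kappa>\<^sub>j \<ge> 3\<close> adding up to \<open>k\<close>, yields
  \<open>2\<^sup>s\<close> codewords in dimension \<open>2k + g s\<close>, any three of which span dimension at least
  \<open>2k + 2g\<close>. Since everything is over \<open>F\<^sub>2\<close>, dimensions are computed by counting elements.
\<close>

section \<open>Dimension by counting over F_2\<close>

lemma finite_bit_vec: "finite (A :: (bit ^ 'n::finite) set)"
proof -
  have "inj_on (\<lambda>v :: bit ^ 'n. {i. v $ i = 1}) A"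
  proof (rule inj_onI)
    fix v w :: "bit ^ 'n"
    assume "{i. v $ i = 1} = {i. w $ i = 1}"
    then have "v $ i = 1 \<longleftrightarrow> w $ i = 1" for i by blast
    then have "v $ i = w $ i" for i by (metis bit.exhaust)
    then show "v = w" by (simp add: vec_eq_iff)
  qed
  then show ?thesis by (rule inj_on_finite[where B = UNIV]) auto
qed

text \<open>The only scalars are 0 and 1, so a vector \<open>a\<close> outside
  \<open>vec.span B\<close> enlarges the span to its disjoint union with its translate by
  \<open>a\<close>: each basis vector doubles the count. This lets dimension bounds be proved by
  counting.\<close>

lemma card_subspace_bit:
  fixes U :: "(bit ^ 'n::finite) set"
  assumes "vec.subspace U"
  shows "card U = 2 ^ vec.dim U"
proof -
  have card_span: "card (vec.span B) = 2 ^ card B" if "finite B" "vec.independent B"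
    for B :: "(bit ^ 'n) set"
    using that
  proof (induction B rule: finite_induct)
    case empty
    then show ?case by simp
  next
    case (insert a B)
    have ind: "vec.independent B" and a: "a \<notin> vec.span B"
      using insert by (auto simp: vec.independent_insert)
    have eq: "vec.span (insert a B) = vec.span B \<union> (+) a ` vec.span B" (is "?L = ?R")
    proof (intro set_eqI iffI)
      fix x assume "x \<in> ?L"
      then obtain c where c: "x - c *s a \<in> vec.span B"
        by (auto simp: vec.span_insert)
      show "x \<in> ?R"
      proof (cases c)
        case zero
        then show ?thesis using c by simp
      next
        case one
        then have "x = a + (x - c *s a)" "x - c *s a \<in> vec.span B" using c by auto
        then show ?thesis by blast
      qed
    next
      fix x assume "x \<in> ?R"
      then show "x \<in> ?L"
        by (auto intro: vec.span_add vec.span_base vec.span_mono[THEN subsetD, of B])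
    qed
    have disj: "vec.span B \<inter> (+) a ` vec.span B = {}"
    proof -
      have False if "y \<in> vec.span B" "a + y \<in> vec.span B" for y
        using vec.span_diff[OF that(2,1)] a by simp
      then show ?thesis by blast
    qed
    have "card (vec.span (insert a B)) = card (vec.span B) + card ((+) a ` vec.span B)"
      unfolding eq by (rule card_Un_disjoint) (use disj in \<open>auto simp: finite_bit_vec\<close>)
    also have "\<dots> = 2 * card (vec.span B)" by (simp add: card_image)
    finally show ?case using insert ind by simp
  qed
  obtain B where B: "B \<subseteq> U" "vec.independent B" "U \<subseteq> vec.span B" "card B = vec.dim U"
    using vec.basis_exists by blast
  have "vec.span B = U"
    using B assms by (simp add: vec.span_minimal subset_antisym)
  then show ?thesis using card_span[of B] B by (simp add: vec.finiteI_independent)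
qed

section \<open>Polynomials over F_2 with prescribed exponents\<close>

definition polys_on :: "nat set \<Rightarrow> bit poly set" where
  "polys_on I = {p. \<forall>i. i \<notin> I \<longrightarrow> coeff p i = 0}"

lemma polys_on_0 [simp]: "0 \<in> polys_on I"
  and polys_on_add: "p \<in> polys_on I \<Longrightarrow> q \<in> polys_on I \<Longrightarrow> p + q \<in> polys_on I"
  and polys_on_diff: "p \<in> polys_on I \<Longrightarrow> q \<in> polys_on I \<Longrightarrow> p - q \<in> polys_on I"
  by (auto simp: polys_on_def)

lemma polys_on_mono: "I \<subseteq> J \<Longrightarrow> polys_on I \<subseteq> polys_on J"
  by (auto simp: polys_on_def)

text \<open>Over F_2 a polynomial is the same thing as its set of exponents, so subsets of
  \<open>I\<close> are being counted.\<close>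

lemma finite_card_polys_on:
  assumes "finite I"
  shows "finite (polys_on I)" and "card (polys_on I) = 2 ^ card I"
proof -
  have monom_sum: "coeff (\<Sum>i\<in>S. monom (1::bit) i) j = (if j \<in> S then 1 else 0)"
    if "S \<subseteq> I" for S j
  proof -
    have "finite S" using that assms by (rule finite_subset)
    then show ?thesis by (simp add: coeff_sum coeff_monom)
  qed
  have "bij_betw (\<lambda>p. {i. coeff p i = 1}) (polys_on I) (Pow I)"
  proof (rule bij_betwI[where g = "\<lambda>S. \<Sum>i\<in>S. monom 1 i"])
    show supp: "(\<lambda>p. {i. coeff p i = 1}) \<in> polys_on I \<rightarrow> Pow I"
      by (force simp: polys_on_def)
    show "(\<lambda>S. \<Sum>i\<in>S. monom 1 i) \<in> Pow I \<rightarrow> polys_on I"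
      by (auto simp: polys_on_def monom_sum)
    fix p assume "p \<in> polys_on I"
    then have sub: "{i. coeff p i = 1} \<subseteq> I" using supp by blast
    show "(\<Sum>i\<in>{i. coeff p i = 1}. monom 1 i) = p"
      unfolding poly_eq_iff monom_sum[OF sub] by simp
  next
    fix S assume "S \<in> Pow I"
    then show "{i. coeff (\<Sum>i\<in>S. monom (1::bit) i) i = 1} = S"
      by (simp add: monom_sum)
  qed
  then show "finite (polys_on I)" "card (polys_on I) = 2 ^ card I"
    using assms by (auto simp: bij_betw_finite bij_betw_same_card card_Pow)
qed

lemma polys_on_lessThan_iff: "p \<in> polys_on {..<d} \<longleftrightarrow> p = 0 \<or> degree p < d"
proof
  assume p: "p \<in> polys_on {..<d}"
  have "degree p < d" if "p \<noteq> 0"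
  proof (rule ccontr)
    assume "\<not> degree p < d"
    then have "coeff p (degree p) = 0" using p unfolding polys_on_def by simp
    with that show False by simp
  qed
  then show "p = 0 \<or> degree p < d" by blast
qed (auto simp: polys_on_def coeff_eq_0)

text \<open>The gap at \<open>k - 1\<close> is what lowers the dimension of \<open>W \<inter> \<rho>W\<close> from the value
  \<open>k - 1\<close>, attained at \<open>\<rho> = x\<close> by the polynomials of degree below \<open>k\<close>, to \<open>k - 2\<close>.\<close>

definition gap_polys :: "nat \<Rightarrow> bit poly set" where
  "gap_polys k = polys_on ({..k} - {k - 1})"

lemma finite_gap_polys: "finite (gap_polys k)"
  by (simp add: gap_polys_def finite_card_polys_on)

lemma card_gap_polys: "0 < k \<Longrightarrow> card (gap_polys k) = 2 ^ k"
  by (simp add: gap_polys_def finite_card_polys_on)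

lemma gap_polys_diff: "p \<in> gap_polys k \<Longrightarrow> q \<in> gap_polys k \<Longrightarrow> p - q \<in> gap_polys k"
  by (simp add: gap_polys_def polys_on_diff)

lemma gap_polysD:
  assumes "p \<in> gap_polys k" "0 < k"
  shows "degree p \<le> k" "coeff p (k - 1) = 0" "degree p \<noteq> k - 1 \<or> p = 0"
proof -
  show 1: "coeff p (k - 1) = 0" using assms by (auto simp: gap_polys_def polys_on_def)
  show "degree p \<le> k" using assms by (intro degree_le) (auto simp: gap_polys_def polys_on_def)
  show "degree p \<noteq> k - 1 \<or> p = 0" using 1 by (metis leading_coeff_0_iff)
qed

section \<open>Bounding the intersection of W with a multiple of itself\<close>

lemma degree_one_bit_poly_cases:
  fixes p :: "bit poly"
  assumes "p \<noteq> 0" "degree p \<le> 1"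
  shows "p = 1 \<or> p = [:0, 1:] \<or> p = [:1, 1:]"
proof -
  have "p = [:coeff p 0, coeff p 1:]"
    using assms(2) by (intro poly_eqI) (auto simp: coeff_pCons coeff_eq_0 split: nat.split)
  then obtain a b where "p = [:a, b:]" by blast
  then show ?thesis using assms(1) by (cases a; cases b) (auto simp: one_pCons)
qed

lemma bit_poly_add_self: "p + p = (0 :: bit poly)"
proof (rule poly_eqI)
  fix i
  have "coeff p i + coeff p i = 0" by (cases "coeff p i") simp_all
  then show "coeff (p + p) i = coeff 0 i" by (simp only: coeff_add coeff_0)
qed

text \<open>Take \<open>q\<close> nonzero of least degree among the possible first components.
  Dividing \<open>u\<close> by \<open>q\<close> leaves a remainder that is again a first component,
  so minimality makes it zero; cancelling \<open>b\<close> then gives \<open>v\<close>.\<close>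

lemma syzygy_generator:
  fixes a b :: "'a::field poly"
  assumes "a \<noteq> 0" "b \<noteq> 0"
  obtains p q where "p \<noteq> 0" "q \<noteq> 0" "a * q = b * p"
    "\<And>u v. a * u = b * v \<Longrightarrow> \<exists>r. u = q * r \<and> v = p * r"
proof -
  define P where "P q \<longleftrightarrow> q \<noteq> 0 \<and> (\<exists>p. a * q = b * p)" for q
  have "P b" unfolding P_def using assms by (auto intro: exI[of _ a])
  then obtain q where q: "P q" and min: "\<And>y. P y \<Longrightarrow> degree q \<le> degree y"
    using ex_has_least_nat[of P b degree] by blast
  then obtain p where p: "q \<noteq> 0" "a * q = b * p" by (auto simp: P_def)
  have gen: "\<exists>r. u = q * r \<and> v = p * r" if uv: "a * u = b * v" for u v
  proof -
    define r where "r = u div q"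
    have u: "u = q * r + u mod q" by (simp add: r_def)
    have "b * (v - p * r) = a * u - a * q * r" by (simp add: uv p right_diff_distrib mult_ac)
    also have "\<dots> = a * (u mod q)" by (subst u) (simp add: ring_distribs mult_ac)
    finally have rem: "a * (u mod q) = b * (v - p * r)" by simp
    have mod0: "u mod q = 0"
    proof (rule ccontr)
      assume nz: "u mod q \<noteq> 0"
      then have "P (u mod q)" using rem by (auto simp: P_def)
      then show False using min[of "u mod q"] degree_mod_less'[OF p(1) nz] by simp
    qed
    then have "v = p * r" using rem assms by simp
    then show ?thesis using u mod0 by auto
  qed
  have "p \<noteq> 0" using p assms by auto
  then show thesis using that p gen by blast
qed

text \<open>A factor of degree at least 3 leaves \<open>r\<close> at most k - 2 free coefficients. A
  factor of degree 2 leaves k - 1, and the gap removes one more. If both factors have degree at most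
  1, they are two of 1, x, x + 1, and their gap conditions are independent.\<close>

lemma card_gap_multiples_le:
  fixes p q :: "bit poly"
  assumes k: "3 \<le> k" and nz: "p \<noteq> 0" "q \<noteq> 0" and neq: "p \<noteq> q"
  defines "R \<equiv> {r. q * r \<in> gap_polys k \<and> p * r \<in> gap_polys k}"
  shows "finite R" and "card R \<le> 2 ^ (k - 2)"
proof -
  have degR: "degree h + degree r \<le> k" if "r \<in> R" "h = p \<or> h = q" "r \<noteq> 0" for r h
    using gap_polysD(1)[of "h * r" k] that k nz by (auto simp: R_def degree_mult_eq)
  have bound: "R \<subseteq> polys_on {..<k + 1 - degree h}" if "h = p \<or> h = q" for h
  proof
    fix r assume "r \<in> R"
    then show "r \<in> polys_on {..<k + 1 - degree h}"
      using degR[of r h] that by (cases "r = 0") (auto simp: polys_on_lessThan_iff)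
  qed
  show finR: "finite R"
    using bound[of p] finite_card_polys_on(1) finite_subset by blast
  have card_sub: "card R \<le> 2 ^ (k - 2)" if "R \<subseteq> polys_on {..<k - 2}"
    using card_mono[OF finite_card_polys_on(1) that] finite_card_polys_on(2)[of "{..<k - 2}"] by simp
  consider "degree p \<le> 1" "degree q \<le> 1"
    | h where "h = p \<or> h = q" "degree h = 2" | h where "h = p \<or> h = q" "degree h \<ge> 3"
  proof -
    have "degree h \<le> 1 \<or> degree h = 2 \<or> degree h \<ge> 3" for h :: "bit poly" by linarith
    then show thesis using that by blast
  qed
  then show "card R \<le> 2 ^ (k - 2)"
  proof cases
    case 1
    define l where "l = k - 3"
    then have l: "k = Suc (Suc (Suc l))" using k by simp
    have "R \<subseteq> polys_on {..<k - 2}"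
    proof
      fix r assume r: "r \<in> R"
      then have c: "coeff (q * r) (Suc (Suc l)) = 0" "coeff (p * r) (Suc (Suc l)) = 0"
        using gap_polysD(2)[of "q * r" k] gap_polysD(2)[of "p * r" k] l by (auto simp: R_def)
      have pq: "p = 1 \<or> p = [:0, 1:] \<or> p = [:1, 1:]" "q = 1 \<or> q = [:0, 1:] \<or> q = [:1, 1:]"
        using 1 nz degree_one_bit_poly_cases by blast+
      \<comment> \<open>With j = k - 1, the coefficient of index j in the product is r_j, r_(j-1) or
        r_(j-1) + r_j when the factor is 1, x or x + 1. Any two of these vanish together only if r_j
        = r_(j-1) = 0.\<close>
      have c1: "coeff r (Suc l) = 0" and c2: "coeff r (Suc (Suc l)) = 0"
        using c pq neq by auto
      have "degree p = 1 \<or> degree q = 1" using pq neq by auto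
      then have "r \<in> polys_on {..<k}"
        using bound[of p] bound[of q] r by auto
      then show "r \<in> polys_on {..<k - 2}"
        unfolding polys_on_def
      proof (clarsimp simp: not_less)
        fix i assume i: "k - 2 \<le> i" and r: "\<forall>i\<ge>k. coeff r i = 0"
        from i have "i = Suc l \<or> i = Suc (Suc l) \<or> k \<le> i" using l by linarith
        then show "coeff r i = 0" using c1 c2 r by blast
      qed
    qed
    then show ?thesis by (rule card_sub)
  next
    case 2
    \<comment> \<open>The exponent is chosen so that \<open>h * M\<close> has degree exactly k - 1,
      the forbidden one. Hence \<open>M\<close> is not in \<open>R\<close>, and the disjoint sets
      \<open>R\<close> and \<open>M + R\<close> share a space of size 2^(k-1).\<close>
    define M :: "bit poly" where "M = monom 1 (k - 3)"
    have sub: "R \<subseteq> polys_on {..<k - 1}" using bound[OF 2(1)] 2(2) k by simp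
    have "M \<noteq> 0" by (simp add: M_def monom_eq_0_iff)
    moreover have "h \<noteq> 0" using 2 nz by auto
    ultimately have "degree (h * M) = k - 1" "h * M \<noteq> 0"
      using 2 k by (auto simp: degree_mult_eq M_def degree_monom_eq)
    then have "h * M \<notin> gap_polys k" using gap_polysD(3)[of "h * M" k] k by auto
    then have MR: "M \<notin> R" using 2 by (auto simp: R_def)
    have diff: "x - y \<in> R" if "x \<in> R" "y \<in> R" for x y
      using that by (auto simp: R_def right_diff_distrib gap_polys_diff)
    have disj: "R \<inter> (+) M ` R = {}"
    proof -
      have False if "y \<in> R" "M + y \<in> R" for y
        using diff[OF that(2,1)] MR by simp
      then show ?thesis by blast
    qed
    have M: "M \<in> polys_on {..<k - 1}" using k by (auto simp: M_def polys_on_def)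
    have "2 * card R = card R + card ((+) M ` R)" by (simp add: card_image)
    also have "\<dots> = card (R \<union> (+) M ` R)"
      using disj finR by (simp add: card_Un_disjoint)
    also have "\<dots> \<le> card (polys_on {..<k - 1})"
      using sub M by (intro card_mono finite_card_polys_on(1)) (auto intro: polys_on_add)
    also have "\<dots> = 2 * 2 ^ (k - 2)"
      using k by (simp add: finite_card_polys_on(2) flip: power_Suc)
    finally show ?thesis by simp
  next
    case 3
    have "{..<k + 1 - degree h} \<subseteq> {..<k - 2}" using 3(2) by auto
    then have "R \<subseteq> polys_on {..<k - 2}"
      using bound[OF 3(1)] polys_on_mono by blast
    then show ?thesis by (rule card_sub)
  qed
qed

text \<open>Projection to \<open>u\<close> identifies \<open>K\<close> with the intersection of W
  and (b/a) W. All syzygies are multiples of one pair (q, p), and \<open>a\<close> \<noteq>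
  \<open>b\<close> gives \<open>p\<close> \<noteq> \<open>q\<close>, which excludes the ratio
  1.\<close>

lemma card_gap_syzygies_le:
  fixes a b :: "bit poly"
  assumes k: "3 \<le> k" and nz: "a \<noteq> 0" "b \<noteq> 0" and neq: "a \<noteq> b"
  defines "K \<equiv> {(u, v). u \<in> gap_polys k \<and> v \<in> gap_polys k \<and> a * u = b * v}"
  shows "finite K" and "card K \<le> 2 ^ (k - 2)"
proof -
  obtain p q where pq: "p \<noteq> 0" "q \<noteq> 0" "a * q = b * p"
    and gen: "\<And>u v. a * u = b * v \<Longrightarrow> \<exists>r. u = q * r \<and> v = p * r"
    using syzygy_generator[OF nz] by metis
  have "p \<noteq> q" using pq neq by auto
  define R where "R = {r. q * r \<in> gap_polys k \<and> p * r \<in> gap_polys k}"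
  have R: "finite R" "card R \<le> 2 ^ (k - 2)"
    unfolding R_def using card_gap_multiples_le[OF k pq(1,2) \<open>p \<noteq> q\<close>] by auto
  have sub: "K \<subseteq> (\<lambda>r. (q * r, p * r)) ` R"
  proof
    fix x assume "x \<in> K"
    then obtain u v where x: "x = (u, v)" "u \<in> gap_polys k" "v \<in> gap_polys k" "a * u = b * v"
      by (auto simp: K_def)
    obtain r where "u = q * r" "v = p * r" using gen[OF x(4)] by blast
    then show "x \<in> (\<lambda>r. (q * r, p * r)) ` R" using x by (auto simp: R_def)
  qed
  show "finite K" using sub R(1) finite_surj by blast
  have "card K \<le> card R" using surj_card_le[OF R(1) sub] .
  then show "card K \<le> 2 ^ (k - 2)" using R(2) by simp
qed

section \<open>Lifted spaces and the sum of three of them\<close>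

lemma card_le_card_image_times:
  assumes "finite A" and "\<And>x. x \<in> A \<Longrightarrow> card {y \<in> A. f y = f x} \<le> c"
  shows "card A \<le> card (f ` A) * c"
proof -
  have "card A = (\<Sum>z\<in>f ` A. card {y \<in> A. f y = z})"
    using sum.image_gen[OF assms(1), of "\<lambda>_. 1::nat" f] by simp
  also have "\<dots> \<le> (\<Sum>z\<in>f ` A. c)"
    using assms(2) by (intro sum_mono) auto
  finally show ?thesis by simp
qed

text \<open>The two summands occupy disjoint ranges of exponents, so a pair packed into one
  polynomial can be read off componentwise.\<close>

lemma low_high_split_eq_0:
  fixes p q :: "'a::comm_ring_1 poly"
  assumes "degree p \<le> k" and "p + monom 1 (k + 1) * q = 0"
  shows "p = 0" and "q = 0"
proof -
  have c: "coeff p i + coeff (monom 1 (k + 1) * q) i = 0" for i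
    using assms(2) by (metis coeff_0 coeff_add)
  have "coeff p i = 0" for i
  proof (cases "i \<le> k")
    case True
    then show ?thesis using c[of i] by (simp add: coeff_monom_mult)
  next
    case False
    then show ?thesis using assms(1) by (simp add: coeff_eq_0)
  qed
  then show "p = 0" by (simp add: poly_eq_iff)
  have "coeff q i = 0" for i
    using c[of "i + (k + 1)"] \<open>p = 0\<close> by (simp add: coeff_monom_mult)
  then show "q = 0" by (simp add: poly_eq_iff)
qed

text \<open>Multiplication by \<open>lift_poly k f\<close> sends \<open>v\<close> of degree at most \<open>k\<close> to the pair
  \<open>(v, f v)\<close>, stored in the coefficients up to \<open>k\<close> and above \<open>k\<close> respectively.\<close>

definition lift_poly :: "nat \<Rightarrow> bit poly \<Rightarrow> bit poly" where
  "lift_poly k f = 1 + monom 1 (k + 1) * f"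

lemma lift_poly_nonzero: "lift_poly k f \<noteq> 0"
  using low_high_split_eq_0(1)[of 1 k f] by (auto simp: lift_poly_def)

text \<open>A triple is sent to zero only if \<open>w\<close> = -(u + v) and (u, v) is a syzygy of
  the differences of the f's. So fibres have at most 2^(k-2) elements, and 3k - (k - 2) = 2k +
  2.\<close>

lemma card_three_sums_ge:
  assumes k: "3 \<le> k" and ne: "f1 \<noteq> f2" "f1 \<noteq> f3" "f2 \<noteq> f3"
  defines "\<phi> \<equiv> \<lambda>(u, v, w). lift_poly k f1 * u + lift_poly k f2 * v + lift_poly k f3 * w"
  shows "2 ^ (2 * k + 2) \<le> card (\<phi> ` (gap_polys k \<times> gap_polys k \<times> gap_polys k))"
proof -
  let ?A = "gap_polys k \<times> gap_polys k \<times> gap_polys k"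
  define K where "K = {(u, v). u \<in> gap_polys k \<and> v \<in> gap_polys k \<and> (f1 - f3) * u = (f3 - f2) * v}"
  \<comment> \<open>In characteristic 2 equality would give f1 + f2 = 0, that is f1 = f2.\<close>
  have "f1 - f3 \<noteq> f3 - f2"
  proof
    assume "f1 - f3 = f3 - f2"
    then have "f1 + f2 = f3 + f3" by (simp add: algebra_simps)
    then have "f1 + f2 = f2 + f2" by (simp only: bit_poly_add_self)
    then show False using ne by (simp only: add_right_cancel)
  qed
  then have K: "finite K" "card K \<le> 2 ^ (k - 2)"
    unfolding K_def using card_gap_syzygies_le[OF k, of "f1 - f3" "f3 - f2"] ne by auto
  have ker: "w = - (u + v) \<and> (f1 - f3) * u = (f3 - f2) * v"
    if uvw: "u \<in> gap_polys k" "v \<in> gap_polys k" "w \<in> gap_polys k" and z: "\<phi> (u, v, w) = 0" for u v w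
  proof -
    have deg: "degree (u + v + w) \<le> k"
      using uvw k by (intro degree_add_le) (auto dest: gap_polysD(1))
    have "(u + v + w) + monom 1 (k + 1) * (f1 * u + f2 * v + f3 * w) = 0"
      using z by (simp add: \<phi>_def lift_poly_def algebra_simps)
    note s = low_high_split_eq_0[OF deg this]
    have w: "w = - (u + v)" using s(1) by (metis add.commute eq_neg_iff_add_eq_0)
    have "(f1 - f3) * u - (f3 - f2) * v = 0"
      using s(2) unfolding w by (simp add: algebra_simps)
    then show ?thesis using w by simp
  qed
  \<comment> \<open>Subtracting the base point \<open>x\<close> moves its fibre into the kernel,
    where the first two components determine the third.\<close>
  have fib: "card {y \<in> ?A. \<phi> y = \<phi> x} \<le> card K" if x: "x \<in> ?A" for x
  proof (rule card_inj_on_le[OF _ _ K(1)])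
    obtain a b c where abc: "x = (a, b, c)" by (cases x)
    have *: "w - c = - ((u - a) + (v - b)) \<and> (u - a, v - b) \<in> K"
      if "(u, v, w) \<in> ?A" "\<phi> (u, v, w) = \<phi> x" for u v w
    proof -
      have "\<phi> (u - a, v - b, w - c) = 0"
        using that(2) abc by (simp add: \<phi>_def algebra_simps)
      then show ?thesis
        using ker[of "u - a" "v - b" "w - c"] that(1) x abc by (auto simp: gap_polys_diff K_def)
    qed
    show "inj_on (\<lambda>(u, v, w). (u - fst x, v - fst (snd x))) {y \<in> ?A. \<phi> y = \<phi> x}"
    proof (rule inj_onI)
      fix y z assume y: "y \<in> {y \<in> ?A. \<phi> y = \<phi> x}" and z: "z \<in> {y \<in> ?A. \<phi> y = \<phi> x}"
        and eq: "(case y of (u, v, w) \<Rightarrow> (u - fst x, v - fst (snd x))) =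
          (case z of (u, v, w) \<Rightarrow> (u - fst x, v - fst (snd x)))"
      obtain u v w where y': "y = (u, v, w)" by (cases y)
      obtain u' v' w' where z': "z = (u', v', w')" by (cases z)
      have "u = u'" "v = v'" using eq y' z' by auto
      moreover from this have "w - c = w' - c" using *[of u v w] *[of u' v' w'] y z y' z' by auto
      ultimately show "y = z" using y' z' by simp
    qed
    show "(\<lambda>(u, v, w). (u - fst x, v - fst (snd x))) ` {y \<in> ?A. \<phi> y = \<phi> x} \<subseteq> K"
      using * abc by auto
  qed
  have "2 ^ (2 * k + 2) * 2 ^ (k - 2) = (2::nat) ^ (k + (k + k))"
    unfolding power_add[symmetric] using k by (intro arg_cong[where f = "power 2"]) simp
  also have "\<dots> = card ?A"
    using k by (simp add: card_cartesian_product card_gap_polys power_add)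
  also have "\<dots> \<le> card (\<phi> ` ?A) * card K"
    by (rule card_le_card_image_times) (use fib finite_gap_polys in auto)
  also have "\<dots> \<le> card (\<phi> ` ?A) * 2 ^ (k - 2)" using K(2) by simp
  finally show ?thesis by simp
qed

text \<open>The product \<open>f * v\<close> has degree at most k + s - 1 and is shifted by k + 1,
  so exponents end at 2k + s. Since the gap at k - 1 survives, exactly 2k + s exponents remain,
  which is the room one block needs.\<close>

lemma lift_poly_mult_in_polys_on:
  assumes v: "v \<in> gap_polys k" and k: "0 < k" and f: "f \<in> polys_on {..<s}"
  shows "lift_poly k f * v \<in> polys_on ({..2 * k + s} - {k - 1})"
proof -
  have c: "coeff (lift_poly k f * v) i = coeff v i + (if k + 1 \<le> i then coeff (f * v) (i - (k + 1)) else 0)"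
    for i by (simp add: lift_poly_def distrib_right mult.assoc coeff_monom_mult)
  have "coeff (f * v) i = 0" if "k + s \<le> i" for i
  proof (cases "f = 0")
    case False
    then have "degree f < s" using f by (simp add: polys_on_lessThan_iff)
    then have "degree (f * v) < i"
      using degree_mult_le[of f v] gap_polysD(1)[OF v k] that by linarith
    then show ?thesis by (rule coeff_eq_0)
  qed simp
  moreover have "coeff v i = 0" if "k < i" for i
    using gap_polysD(1)[OF v k] that by (simp add: coeff_eq_0)
  ultimately show ?thesis
    using gap_polysD(2)[OF v k] k by (auto simp: polys_on_def c)
qed

text \<open>W contains 1, so the pair (1, f) equals some (v, f' v); the low part forces v = 1 and
  the high part f = f'.\<close>

lemma lift_poly_image_inj:
  assumes k: "3 \<le> k"
    and eq: "(*) (lift_poly k f) ` gap_polys k = (*) (lift_poly k f') ` gap_polys k"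
  shows "f = f'"
proof -
  have one: "1 \<in> gap_polys k" using k by (auto simp: gap_polys_def polys_on_def)
  then have "lift_poly k f * 1 \<in> (*) (lift_poly k f') ` gap_polys k"
    unfolding eq[symmetric] by (rule imageI)
  then obtain v where v: "v \<in> gap_polys k" "lift_poly k f = lift_poly k f' * v" by auto
  have deg: "degree (1 - v) \<le> k" using gap_polysD(1)[OF gap_polys_diff[OF one v(1)]] k by simp
  have "(1 - v) + monom 1 (k + 1) * (f - f' * v) = 0"
    using v(2) by (simp add: lift_poly_def algebra_simps)
  from low_high_split_eq_0[OF deg this] show ?thesis by simp
qed

section \<open>Assembling the blocks into a code in F_2^n\<close>

lemma ex_range_eq:
  assumes "finite I" "I \<noteq> {}" "card I \<le> CARD('n::finite)"
  shows "\<exists>e :: 'n \<Rightarrow> 'a. range e = I"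
proof -
  obtain h :: "'a \<Rightarrow> 'n" where h: "inj_on h I"
    using card_le_inj[OF assms(1) finite_class.finite_UNIV assms(3)] by blast
  obtain a where a: "a \<in> I" using assms(2) by blast
  define e where "e i = (if i \<in> h ` I then inv_into I h i else a)" for i
  have "e i \<in> I" for i by (simp add: e_def a inv_into_into)
  moreover have "e (h x) = x" if "x \<in> I" for x using that h by (simp add: e_def)
  ultimately have "range e = I" by (metis image_subset_iff rangeI subsetI subset_antisym)
  then show ?thesis by blast
qed

text \<open>Sizes multiply over the blocks, and each block contributes two dimensions beyond twice
  its size, whence the condition \<gamma> \<le> 2g. Block sizes may vary because g need not divide
  k.\<close>

lemma ex_covering_code:
  fixes \<kappa> :: "nat \<Rightarrow> nat" and g s :: nat
  assumes g: "0 < g" and \<kappa>: "\<And>j. j < g \<Longrightarrow> 3 \<le> \<kappa> j"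
    and room: "(\<Sum>j<g. 2 * \<kappa> j + s) \<le> CARD('n::finite)"
    and k: "k = (\<Sum>j<g. \<kappa> j)" and \<gamma>: "\<gamma> \<le> 2 * g"
  shows "\<exists>C :: (bit ^ 'n) set set. covering_code 3 k (k + \<gamma>) C \<and> card C = 2 ^ s"
proof -
  define J where "J j = {..2 * \<kappa> j + s} - {\<kappa> j - 1}" for j
  have cardJ: "card (J j) = 2 * \<kappa> j + s" for j by (simp add: J_def)
  have "(0, \<kappa> 0) \<in> Sigma {..<g} J" using g \<kappa>[of 0] by (auto simp: J_def)
  then have "Sigma {..<g} J \<noteq> {}" by blast
  moreover have "card (Sigma {..<g} J) = (\<Sum>j<g. 2 * \<kappa> j + s)"
    by (subst card_SigmaI) (auto simp: J_def cardJ[unfolded J_def])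
  moreover have "finite (Sigma {..<g} J)" by (auto simp: J_def)
  \<comment> \<open>Each of the n coordinates is assigned a (block, exponent) pair. Surplus
    coordinates merely repeat pairs; surjectivity is what makes reading off coefficients
    injective.\<close>
  ultimately obtain e :: "'n \<Rightarrow> nat \<times> nat" where e: "range e = Sigma {..<g} J"
    using ex_range_eq[of "Sigma {..<g} J"] room by auto
  have e_lt: "fst (e i) < g" for i
    using rangeI[of e i] unfolding e by auto
  define E :: "(nat \<Rightarrow> bit poly) \<Rightarrow> bit ^ 'n"
    where "E P = (\<chi> i. coeff (P (fst (e i))) (snd (e i)))" for P
  \<comment> \<open>The restriction keeps the sum inside the extensional product, on which
    \<open>E\<close> is injective.\<close>
  have E_add: "E (\<lambda>j\<in>{..<g}. x j + y j) = E x + E y" for x y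
    by (simp add: E_def vec_eq_iff e_lt)
  have E_0: "E (\<lambda>j\<in>{..<g}. 0) = 0" by (simp add: E_def vec_eq_iff e_lt)
  have E_inj: "inj_on E (\<Pi>\<^sub>E j\<in>{..<g}. polys_on (J j))"
  proof (rule inj_onI)
    fix x y assume x: "x \<in> (\<Pi>\<^sub>E j\<in>{..<g}. polys_on (J j))"
      and y: "y \<in> (\<Pi>\<^sub>E j\<in>{..<g}. polys_on (J j))" and eq: "E x = E y"
    have "coeff (x j) c = coeff (y j) c" if j: "j < g" for j c
    proof (cases "c \<in> J j")
      case True
      then have "(j, c) \<in> range e" using e j by simp
      then obtain i where "e i = (j, c)" by (auto simp: image_iff)
      moreover have "E x $ i = E y $ i" by (simp add: eq)
      ultimately show ?thesis by (simp add: E_def)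
    next
      case False
      moreover have "x j \<in> polys_on (J j)" "y j \<in> polys_on (J j)" using x y j by auto
      ultimately show ?thesis by (simp add: polys_on_def)
    qed
    then have "x j = y j" if "j < g" for j using that by (simp add: poly_eq_iff)
    then show "x = y" using x y by (intro PiE_ext) auto
  qed
  have card_E: "card (E ` (\<Pi>\<^sub>E j\<in>{..<g}. T j)) = (\<Prod>j<g. card (T j))"
    if "\<And>j. j < g \<Longrightarrow> T j \<subseteq> polys_on (J j)" for T
  proof -
    have "(\<Pi>\<^sub>E j\<in>{..<g}. T j) \<subseteq> (\<Pi>\<^sub>E j\<in>{..<g}. polys_on (J j))"
      using that by (intro PiE_mono) auto
    then show ?thesis using E_inj by (simp add: card_image inj_on_subset card_PiE)
  qed
  define X where "X f j = (*) (lift_poly (\<kappa> j) f) ` gap_polys (\<kappa> j)" for f j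
  define U where "U f = E ` (\<Pi>\<^sub>E j\<in>{..<g}. X f j)" for f
  have X_sub: "X f j \<subseteq> polys_on (J j)" if "f \<in> polys_on {..<s}" "j < g" for f j
    using that(1) \<kappa>[OF that(2)] unfolding X_def J_def
    by (intro image_subsetI lift_poly_mult_in_polys_on) simp_all
  have X_0: "0 \<in> X f j" for f j by (auto simp: X_def gap_polys_def image_iff intro: bexI[of _ 0])
  have X_add: "p + q \<in> X f j" if "p \<in> X f j" "q \<in> X f j" for p q f j
    using that by (auto simp: X_def gap_polys_def polys_on_add simp flip: distrib_left)
  have subspace: "vec.subspace (U f)" for f
    unfolding vec.subspace_def
  proof (intro conjI ballI allI)
    have "(\<lambda>j\<in>{..<g}. 0) \<in> (\<Pi>\<^sub>E j\<in>{..<g}. X f j)"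
      unfolding restrict_PiE_iff using X_0 by blast
    then show zero: "0 \<in> U f" unfolding U_def E_0[symmetric] by (rule imageI)
    fix a assume a: "a \<in> U f"
    show "c *s a \<in> U f" for c using zero a by (cases c) auto
    fix b assume "b \<in> U f"
    then obtain x y where "x \<in> (\<Pi>\<^sub>E j\<in>{..<g}. X f j)" "y \<in> (\<Pi>\<^sub>E j\<in>{..<g}. X f j)"
      and ab: "a = E x" "b = E y" using a by (auto simp: U_def)
    then have "(\<lambda>j\<in>{..<g}. x j + y j) \<in> (\<Pi>\<^sub>E j\<in>{..<g}. X f j)"
      unfolding restrict_PiE_iff by (blast intro: X_add dest: PiE_mem)
    then show "a + b \<in> U f" unfolding U_def ab E_add[symmetric] by (rule imageI)
  qed
  have dimU: "vec.dim (U f) = k" if f: "f \<in> polys_on {..<s}" for f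
  proof -
    have cX: "card (X f j) = 2 ^ \<kappa> j" if "j < g" for j
    proof -
      have "inj_on ((*) (lift_poly (\<kappa> j) f)) (gap_polys (\<kappa> j))"
        by (rule inj_onI) (simp add: lift_poly_nonzero)
      then have "card (X f j) = card (gap_polys (\<kappa> j))" unfolding X_def by (rule card_image)
      then show ?thesis using \<kappa>[OF that] by (simp add: card_gap_polys)
    qed
    have "card (U f) = (\<Prod>j<g. card (X f j))"
      unfolding U_def by (rule card_E) (rule X_sub[OF f])
    also have "\<dots> = 2 ^ k" using cX by (simp add: k power_sum)
    finally show ?thesis using card_subspace_bit[OF subspace, of f] by simp
  qed
  have U_inj: "inj_on U (polys_on {..<s})"
  proof (rule inj_onI)
    fix f f' assume f: "f \<in> polys_on {..<s}" "f' \<in> polys_on {..<s}" and eq: "U f = U f'"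
    have "(\<Pi>\<^sub>E j\<in>{..<g}. X h j) \<subseteq> (\<Pi>\<^sub>E j\<in>{..<g}. polys_on (J j))" if "h \<in> polys_on {..<s}" for h
      using X_sub[OF that] by (intro PiE_mono) auto
    then have "(\<Pi>\<^sub>E j\<in>{..<g}. X f j) = (\<Pi>\<^sub>E j\<in>{..<g}. X f' j)"
      using eq f unfolding U_def by (metis E_inj inj_on_image_eq_iff)
    moreover have "X h j \<noteq> {}" for h j using X_0 by blast
    \<comment> \<open>Equal products of nonempty sets have equal factors, and block 0 alone already
      determines f.\<close>
    ultimately have "X f 0 = X f' 0" using g by (subst (asm) PiE_eq_iff_not_empty) auto
    then show "f = f'" unfolding X_def by (rule lift_poly_image_inj[OF \<kappa>[OF g]])
  qed
  have span3: "2 * k + 2 * g \<le> vec.dim (vec.span (U f1 \<union> U f2 \<union> U f3))"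
    if f: "f1 \<in> polys_on {..<s}" "f2 \<in> polys_on {..<s}" "f3 \<in> polys_on {..<s}"
      and ne: "f1 \<noteq> f2" "f1 \<noteq> f3" "f2 \<noteq> f3" for f1 f2 f3
  proof -
    let ?G = "\<lambda>j. gap_polys (\<kappa> j)"
    define Z where "Z j = (\<lambda>(u, v, w). lift_poly (\<kappa> j) f1 * u + lift_poly (\<kappa> j) f2 * v
      + lift_poly (\<kappa> j) f3 * w) ` (?G j \<times> ?G j \<times> ?G j)" for j
    have Z_iff: "z \<in> Z j \<longleftrightarrow> (\<exists>a\<in>X f1 j. \<exists>b\<in>X f2 j. \<exists>c\<in>X f3 j. z = a + b + c)" for z j
      unfolding Z_def X_def by force
    have Z_sub: "Z j \<subseteq> polys_on (J j)" if "j < g" for j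
    proof
      fix z assume "z \<in> Z j"
      then obtain a b c where "a \<in> X f1 j" "b \<in> X f2 j" "c \<in> X f3 j" "z = a + b + c"
        unfolding Z_iff by blast
      then show "z \<in> polys_on (J j)"
        using X_sub[OF f(1) that] X_sub[OF f(2) that] X_sub[OF f(3) that]
        by (auto intro!: polys_on_add)
    qed
    \<comment> \<open>Blockwise sums of three can be regrouped: the summands are chosen
      independently in each block and collected into one element of each codeword.\<close>
    have "E ` (\<Pi>\<^sub>E j\<in>{..<g}. Z j) \<subseteq> vec.span (U f1 \<union> U f2 \<union> U f3)"
    proof
      fix t assume "t \<in> E ` (\<Pi>\<^sub>E j\<in>{..<g}. Z j)"
      then obtain z where z: "z \<in> (\<Pi>\<^sub>E j\<in>{..<g}. Z j)" and t: "t = E z" by blast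
      have "\<forall>j\<in>{..<g}. \<exists>a b c. a \<in> X f1 j \<and> b \<in> X f2 j \<and> c \<in> X f3 j \<and> z j = a + b + c"
        using z Z_iff by blast
      then obtain a b c where abc: "\<forall>j\<in>{..<g}. a j \<in> X f1 j \<and> b j \<in> X f2 j \<and> c j \<in> X f3 j \<and> z j = a j + b j + c j"
        by metis
      have "t = E (restrict a {..<g}) + E (restrict b {..<g}) + E (restrict c {..<g})"
        unfolding t using abc by (simp add: E_def vec_eq_iff e_lt)
      moreover have "E (restrict a {..<g}) \<in> U f1" "E (restrict b {..<g}) \<in> U f2"
        "E (restrict c {..<g}) \<in> U f3"
        unfolding U_def using abc by (intro imageI; simp only: restrict_PiE_iff; blast)+
      ultimately show "t \<in> vec.span (U f1 \<union> U f2 \<union> U f3)"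
        by (auto intro!: vec.span_add intro: vec.span_base)
    qed
    then have "card (E ` (\<Pi>\<^sub>E j\<in>{..<g}. Z j)) \<le> card (vec.span (U f1 \<union> U f2 \<union> U f3))"
      by (intro card_mono finite_bit_vec)
    moreover have "card (E ` (\<Pi>\<^sub>E j\<in>{..<g}. Z j)) = (\<Prod>j<g. card (Z j))"
      by (rule card_E) (rule Z_sub)
    moreover have "(\<Prod>j<g. 2 ^ (2 * \<kappa> j + 2)) \<le> (\<Prod>j<g. card (Z j))"
      unfolding Z_def using \<kappa> ne by (intro prod_mono conjI card_three_sums_ge) auto
    moreover have "(\<Prod>j<g. (2::nat) ^ (2 * \<kappa> j + 2)) = 2 ^ (2 * k + 2 * g)"
    proof -
      have "(\<Sum>j<g. 2 * \<kappa> j + 2) = 2 * k + 2 * g"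
        by (simp only: k sum.distrib sum_distrib_left) simp
      then show ?thesis by (metis power_sum)
    qed
    ultimately have "(2::nat) ^ (2 * k + 2 * g) \<le> 2 ^ vec.dim (vec.span (U f1 \<union> U f2 \<union> U f3))"
      by (simp only: card_subspace_bit[OF vec.subspace_span])
    then show ?thesis by (rule power_le_imp_le_exp[rotated]) simp
  qed
  define C where "C = U ` polys_on {..<s}"
  have "covering_code 3 k (k + \<gamma>) C"
    unfolding covering_code_def
  proof (intro conjI allI impI)
    show "C \<subseteq> grassmannian k" using subspace dimU by (auto simp: C_def grassmannian_def)
    fix S assume S: "S \<subseteq> C" "card S = 3"
    then obtain x y z where xyz: "S = {x, y, z}" "x \<noteq> y" "y \<noteq> z" "x \<noteq> z"
      unfolding card_3_iff by blast
    then obtain f1 f2 f3 where "x = U f1" "y = U f2" "z = U f3"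
      "f1 \<in> polys_on {..<s}" "f2 \<in> polys_on {..<s}" "f3 \<in> polys_on {..<s}"
      using S(1) by (auto simp: C_def)
    moreover from this have "f1 \<noteq> f2" "f1 \<noteq> f3" "f2 \<noteq> f3" using xyz by auto
    moreover have "\<Union>S = x \<union> y \<union> z" using xyz(1) by auto
    ultimately show "k + (k + \<gamma>) \<le> vec.dim (vec.span (\<Union>S))"
      using span3[of f1 f2 f3] \<gamma> by simp
  qed
  moreover have "card C = 2 ^ s"
    using U_inj by (simp add: C_def card_image finite_card_polys_on)
  ultimately show ?thesis by blast
qed

section \<open>Choice of block sizes and degree bound\<close>

theorem mainTheorem10:
  fixes n k \<gamma> :: nat
  assumes "CARD('n::finite) = n"
    and "0 < n" and "0 < k" and "0 < \<gamma>"
    and "3 * nat \<lceil>real \<gamma> / 2\<rceil> \<le> k"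
    and "2 * k + \<gamma> \<le> n"
  shows "2 ^ (((n - 2 * k + 1) div (k + 1)) * (k div nat \<lceil>real \<gamma> / 2\<rceil>))
           \<le> B2 TYPE('n) k (k + \<gamma>) 3"
proof -
  define g where "g = nat \<lceil>real \<gamma> / 2\<rceil>"
  define t where "t = (n - 2 * k + 1) div (k + 1)"
  define m where "m = k div g"
  \<comment> \<open>Block 0 absorbs the remainder of k modulo g; every block has size at least m,
    and m \<ge> 3 because k \<ge> 3g.\<close>
  define \<kappa> where "\<kappa> j = (if j = 0 then m + k mod g else m)" for j :: nat
  have "real \<gamma> / 2 \<le> real g" unfolding g_def by (rule real_nat_ceiling_ge)
  then have \<gamma>: "\<gamma> \<le> 2 * g" by linarith
  then have g: "0 < g" using assms(4) by simp
  have "3 \<le> m" unfolding m_def using assms(5) g by (simp add: less_eq_div_iff_mult_less_eq g_def[symmetric])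
  then have \<kappa>3: "3 \<le> \<kappa> j" for j by (simp add: \<kappa>_def)
  have "(\<Sum>j<g. \<kappa> j) = (\<Sum>j<g. m + (if j = 0 then k mod g else 0))"
    by (intro sum.cong) (auto simp: \<kappa>_def)
  also have "\<dots> = g * m + k mod g" using g by (simp add: sum.distrib)
  also have "\<dots> = k" by (simp add: m_def)
  finally have k: "k = (\<Sum>j<g. \<kappa> j)" by simp
  have "t * (k + 1) \<le> n - 2 * k + 1" unfolding t_def by (rule div_times_less_eq_dividend)
  \<comment> \<open>For t \<ge> 1, dropping t from t (k + 1) compensates the + 1 in n - 2k + 1. Thus
    g blocks with degree bound s = t m need 2k + g t m \<le> 2k + t k \<le> n coordinates.\<close>
  then have "t * k \<le> n - 2 * k" using assms(6) by (cases t) auto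
  moreover have "g * (t * m) \<le> t * k"
    using mult_le_mono2[of "g * m" k t] by (simp add: m_def mult_ac)
  moreover have "(\<Sum>j<g. 2 * \<kappa> j + t * m) = 2 * k + g * (t * m)"
    by (subst k) (simp add: sum.distrib sum_distrib_left)
  ultimately have "(\<Sum>j<g. 2 * \<kappa> j + t * m) \<le> CARD('n)" using assms(1,6) by linarith
  from ex_covering_code[OF g \<kappa>3 this k \<gamma>] obtain C :: "(bit ^ 'n) set set"
    where C: "covering_code 3 k (k + \<gamma>) C" "card C = 2 ^ (t * m)" by blast
  \<comment> \<open>Finiteness is needed since \<open>B2\<close> is a \<open>Max\<close>, which
    bounds its members only for finite sets.\<close>
  have "finite (UNIV :: (bit ^ 'n) set set)"
    using finite_bit_vec[of "UNIV :: (bit ^ 'n) set"] by (simp add: Finite_Set.finite_set)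
  then have "finite (UNIV :: (bit ^ 'n) set set set)" by (simp add: Finite_Set.finite_set)
  then have "finite (card ` {C :: (bit ^ 'n) set set. covering_code 3 k (k + \<gamma>) C})"
    by (intro finite_imageI) (rule finite_subset[OF subset_UNIV])
  then have "card C \<le> B2 TYPE('n) k (k + \<gamma>) 3"
    unfolding B2_def using C(1) by (intro Max_ge) (auto simp: image_Collect)
  then show ?thesis using C(2) by (simp add: t_def m_def g_def)
qed

end
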